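(* Let $S$ be a string of length $n$ over a finite alphabet. There is an algorithm that, for every pair of indices $1\le i\le j\le n$, computes a longest cubic subsequence of the substring $S[i..j]$ (in particular its length), for all $O(n^2)$ substrings simultaneously, in $O(n^6)$ total time and $O(n^3)$ space.
   Context: For a string $S$, $S[i]$ denotes its $i$-th letter and $S[i..j]$ the substring from position $i$ to position $j$. A subsequence of $S$ is a string obtained by deleting some letters of $S$. A cubic subsequence of $S$ is a subsequence of $S$ of the form $X^3=XXX$, where $X$ is a string (necessarily itself a subsequence of $S$). A longest cubic subsequence is one of maximum length. *)

theory Defs
  imports Complex_Main "HOL-Library.Sublist" "HOL-Library.Landau_Symbols"
begin

text \<open>Positions are 1-based, so this is \<open>S[i..j]\<close> for \<open>1 \<le> i \<le> j \<le> length S\<close>.\<close>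

definition substring :: "'a list \<Rightarrow> nat \<Rightarrow> nat \<Rightarrow> 'a list" where
  "substring S i j = take (Suc j - i) (drop (i - 1) S)"

definition cubic_subseq :: "'a list \<Rightarrow> 'a list \<Rightarrow> bool" where
  "cubic_subseq S Y \<longleftrightarrow> subseq Y S \<and> (\<exists>X. Y = X @ X @ X)"

definition longest_cubic_subseq :: "'a list \<Rightarrow> 'a list \<Rightarrow> bool" where
  "longest_cubic_subseq S Y \<longleftrightarrow> is_arg_max length (cubic_subseq S) Y"

text \<open>
  Programs act on registers and on a random access memory, both holding natural numbers.
  A program is a finite object independent of the input and mentions only finitely many
  registers, so the registers amount to constant space.
\<close>

type_synonym reg = nat

type_synonym state = "(reg \<Rightarrow> nat) \<times> (nat \<Rightarrow> nat)"

datatype binop = Add | Sub | Mul | Div | Mod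

fun binop_val :: "binop \<Rightarrow> nat \<Rightarrow> nat \<Rightarrow> nat" where
  "binop_val Add a b = a + b"
| "binop_val Sub a b = a - b"
| "binop_val Mul a b = a * b"
| "binop_val Div a b = a div b"
| "binop_val Mod a b = a mod b"

datatype guard = Eq reg reg | Less reg reg

fun guard_val :: "guard \<Rightarrow> (reg \<Rightarrow> nat) \<Rightarrow> bool" where
  "guard_val (Eq x y) r \<longleftrightarrow> r x = r y"
| "guard_val (Less x y) r \<longleftrightarrow> r x < r y"

datatype com =
    Skip
  | Const reg nat
  | Move reg reg
  | Op binop reg reg reg
  | Load reg reg
  | Store reg reg
  | Seq com com
  | If guard com com
  | While guard com

text \<open>
  \<open>exec N w c s t s'\<close>: on a machine with \<open>N\<close> memory cells and \<open>w\<close>-bit words, command \<open>c\<close>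
  started in \<open>s\<close> halts in \<open>s'\<close> after exactly \<open>t\<close> unit-cost steps. An arithmetic overflow or
  an access to an address \<open>\<ge> N\<close> makes the machine stuck: there is no derivation then.
\<close>

inductive exec :: "nat \<Rightarrow> nat \<Rightarrow> com \<Rightarrow> state \<Rightarrow> nat \<Rightarrow> state \<Rightarrow> bool" for N w where
  Skip: "exec N w Skip s 1 s"
| Const: "k < 2 ^ w \<Longrightarrow> exec N w (Const x k) (r, m) 1 (r(x := k), m)"
| Move: "exec N w (Move x y) (r, m) 1 (r(x := r y), m)"
| Op: "binop_val f (r y) (r z) < 2 ^ w \<Longrightarrow>
    exec N w (Op f x y z) (r, m) 1 (r(x := binop_val f (r y) (r z)), m)"
| Load: "r y < N \<Longrightarrow> exec N w (Load x y) (r, m) 1 (r(x := m (r y)), m)"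
| Store: "r x < N \<Longrightarrow> exec N w (Store x y) (r, m) 1 (r, m(r x := r y))"
| Seq: "exec N w c1 s1 t1 s2 \<Longrightarrow> exec N w c2 s2 t2 s3 \<Longrightarrow> exec N w (Seq c1 c2) s1 (t1 + t2) s3"
| IfTrue: "guard_val b (fst s) \<Longrightarrow> exec N w c1 s t s' \<Longrightarrow> exec N w (If b c1 c2) s (1 + t) s'"
| IfFalse: "\<not> guard_val b (fst s) \<Longrightarrow> exec N w c2 s t s' \<Longrightarrow> exec N w (If b c1 c2) s (1 + t) s'"
| WhileFalse: "\<not> guard_val b (fst s) \<Longrightarrow> exec N w (While b c) s 1 s"
| WhileTrue: "guard_val b (fst s1) \<Longrightarrow> exec N w c s1 t1 s2 \<Longrightarrow> exec N w (While b c) s2 t2 s3 \<Longrightarrow>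
    exec N w (While b c) s1 (1 + t1 + t2) s3"

inductive_cases exec_elims:
  "exec N w Skip s t s'" "exec N w (Const x k) s t s'" "exec N w (Move x y) s t s'"
  "exec N w (Op f x y z) s t s'" "exec N w (Load x y) s t s'" "exec N w (Store x y) s t s'"
  "exec N w (Seq c1 c2) s t s'" "exec N w (If b c1 c2) s t s'"

inductive_cases exec_WhileE: "exec N w (While b c) s t s'"

lemma exec_deterministic:
  assumes "exec N w c s t s'" and "exec N w c s u s''"
  shows "u = t \<and> s'' = s'"
  using assms
proof (induction arbitrary: u s'' rule: exec.induct)
  case (Seq c1 s1 t1 s2 c2 t2 s3)
  from Seq.prems obtain v1 v2 s where "u = v1 + v2" "exec N w c1 s1 v1 s" "exec N w c2 s v2 s''"
    by (auto elim: exec_elims)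
  with Seq.IH show ?case by metis
next
  case (IfTrue b s c1 t s' c2)
  from IfTrue.prems IfTrue.hyps obtain v where "u = 1 + v" "exec N w c1 s v s''"
    by (auto elim: exec_elims)
  with IfTrue.IH show ?case by metis
next
  case (IfFalse b s c2 t s' c1)
  from IfFalse.prems IfFalse.hyps obtain v where "u = 1 + v" "exec N w c2 s v s''"
    by (auto elim: exec_elims)
  with IfFalse.IH show ?case by metis
next
  case (WhileTrue b s1 c t1 s2 t2 s3)
  from WhileTrue.prems WhileTrue.hyps(1) obtain v1 v2 s where "u = 1 + v1 + v2"
    "exec N w c s1 v1 s" "exec N w (While b c) s v2 s''"
    by (auto elim: exec_WhileE)
  with WhileTrue.IH show ?case by metis
next
  case (WhileFalse b s c)
  from WhileFalse.prems WhileFalse.hyps show ?case by (auto elim: exec_WhileE)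
qed (auto elim: exec_elims)

text \<open>
  The input string occupies the first memory cells, its length is in register 0. It has to fit:
  \<open>N\<close> bounds the space for input, output and working storage together.
\<close>

definition init_state :: "nat list \<Rightarrow> state" where
  "init_state S = ((\<lambda>_. 0)(0 := length S), (\<lambda>a. if a < length S then S ! a else 0))"

definition input_fits :: "nat \<Rightarrow> nat \<Rightarrow> nat list \<Rightarrow> bool" where
  "input_fits N w S \<longleftrightarrow> length S \<le> N \<and> length S < 2 ^ w \<and> (\<forall>a\<in>set S. a < 2 ^ w)"

text \<open>A stored string is its length followed by its letters, inside the available memory.\<close>

definition stored_string :: "nat \<Rightarrow> (nat \<Rightarrow> nat) \<Rightarrow> nat \<Rightarrow> nat list \<Rightarrow> bool" where
  "stored_string N m p Y \<longleftrightarrow>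
     p + length Y < N \<and> m p = length Y \<and> (\<forall>k < length Y. m (p + 1 + k) = Y ! k)"

text \<open>
  The output is an \<open>n \<times> n\<close> table of addresses of stored strings, in row-major order,
  whose base address is in register 0.
\<close>

definition longest_cubic_table :: "nat \<Rightarrow> nat list \<Rightarrow> state \<Rightarrow> bool" where
  "longest_cubic_table N S = (\<lambda>(r, m).
     \<forall>i j. 1 \<le> i \<and> i \<le> j \<and> j \<le> length S \<longrightarrow>
       (let q = r 0 + (i - 1) * length S + (j - 1)
        in q < N \<and> (\<exists>Y. longest_cubic_subseq (substring S i j) Y \<and> stored_string N m (m q) Y)))"

end

theory Submission
  imports Defs "HOL-Real_Asymp.Real_Asymp"
begin

text \<open>
  A cubic subsequence \<open>XXX\<close> of \<open>S[i..j]\<close> splits the substring into three parts, each containing \<open>X\<close>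
  as a subsequence, so \<open>X\<close> may be taken to be a longest common subsequence of the three parts.
  Once the two cut positions and the right end are fixed, a single \<open>O(n\<^sup>3)\<close> table over all triples
  of left ends serves every left end \<open>i\<close>: it is read at \<open>i\<close> and the two cut positions. The table is
  reused for each of the \<open>O(n\<^sup>3)\<close> choices, and a traceback of \<open>O(n)\<close> steps stores \<open>XXX\<close> whenever it
  improves on the string found so far for the substring.
\<close>

section \<open>Cubic subsequences and common subsequences of three strings\<close>

text \<open>Fixing the right ends and tabulating over left ends is what lets \<open>i\<close> vary
  for free: a new \<open>i\<close> only changes the cell that is read. A choice of
  \<open>(p, q, e)\<close> costs \<open>O(n^3)\<close> for the table and \<open>O(n^2)\<close> for
  the \<open>n\<close> tracebacks, so the table dominates. Strings have to be written out at once,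
  because the next choice overwrites the table; \<open>n^2\<close> strings of at most
  \<open>n\<close> letters need no more space than the table does. Overflow or an access out of
  range leaves the machine without any derivation, so every intermediate value, also inside address
  arithmetic, has to be bounded; the layout and the word bounds serve this purpose.\<close>

definition slice :: "'a list \<Rightarrow> nat \<Rightarrow> nat \<Rightarrow> 'a list" where
  "slice S i j = take (j - i) (drop i S)"

lemma substring_eq_slice: "1 \<le> i \<Longrightarrow> substring S i j = slice S (i - 1) j"
  by (simp add: substring_def slice_def)

lemma length_slice: "j \<le> length S \<Longrightarrow> length (slice S i j) = j - i"
  by (simp add: slice_def)

lemma slice_empty: "j \<le> i \<Longrightarrow> slice S i j = []"
  by (simp add: slice_def)

lemma slice_Cons: "i < j \<Longrightarrow> j \<le> length S \<Longrightarrow> slice S i j = S ! i # slice S (Suc i) j"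
  by (simp add: slice_def Cons_nth_drop_Suc[symmetric] Suc_diff_Suc[symmetric])

lemma slice_append:
  assumes "i \<le> p" "p \<le> j"
  shows "slice S i p @ slice S p j = slice S i j"
proof -
  have "take (p - i) (drop i S) @ take (j - p) (drop (p - i) (drop i S)) =
      take ((p - i) + (j - p)) (drop i S)"
    by (rule take_add[symmetric])
  then show ?thesis
    using assms by (simp add: slice_def)
qed

text \<open>
  A longest common subsequence of \<open>S[x..<p]\<close>, \<open>S[y..<q]\<close>, \<open>S[z..<e]\<close> (0-based). It is a function
  rather than a relation so that the traceback, which breaks ties in the same order, can be specified
  by equality with it.
\<close>

function lcs3 :: "'a list \<Rightarrow> nat \<Rightarrow> nat \<Rightarrow> nat \<Rightarrow> nat \<Rightarrow> nat \<Rightarrow> nat \<Rightarrow> 'a list" where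
  "lcs3 S p q e x y z =
    (if x < p \<and> y < q \<and> z < e then
       if S ! x = S ! y \<and> S ! y = S ! z then S ! x # lcs3 S p q e (Suc x) (Suc y) (Suc z)
       else
         let A = lcs3 S p q e (Suc x) y z;
             B = lcs3 S p q e x (Suc y) z;
             C = lcs3 S p q e x y (Suc z)
         in if length B \<le> length A \<and> length C \<le> length A then A
            else if length C \<le> length B then B else C
     else [])"
  by pat_completeness auto
termination
  by (relation "measure (\<lambda>(S, p, q, e, x, y, z). (p - x) + (q - y) + (e - z))") auto

declare lcs3.simps [simp del]

lemma lcs3_outside: "\<not> (x < p \<and> y < q \<and> z < e) \<Longrightarrow> lcs3 S p q e x y z = []"
  by (subst lcs3.simps) (simp only: if_False)

lemma lcs3_match:
  assumes "x < p \<and> y < q \<and> z < e" "S ! x = S ! y \<and> S ! y = S ! z"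
  shows "lcs3 S p q e x y z = S ! x # lcs3 S p q e (Suc x) (Suc y) (Suc z)"
  using assms by (subst lcs3.simps) simp

lemma lcs3_mismatch:
  assumes "x < p \<and> y < q \<and> z < e" "\<not> (S ! x = S ! y \<and> S ! y = S ! z)"
  shows "lcs3 S p q e x y z =
    (let A = lcs3 S p q e (Suc x) y z;
         B = lcs3 S p q e x (Suc y) z;
         C = lcs3 S p q e x y (Suc z)
     in if length B \<le> length A \<and> length C \<le> length A then A
        else if length C \<le> length B then B else C)"
  by (subst lcs3.simps, simp only: assms if_True if_False simp_thms)

lemma subseq_lcs3:
  assumes "p \<le> length S" "q \<le> length S" "e \<le> length S"
  shows "subseq (lcs3 S p q e x y z) (slice S x p) \<and>
    subseq (lcs3 S p q e x y z) (slice S y q) \<and> subseq (lcs3 S p q e x y z) (slice S z e)"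
  using assms
proof (induction S p q e x y z rule: lcs3.induct)
  case (1 S p q e x y z)
  show ?case
  proof (cases "x < p \<and> y < q \<and> z < e")
    case True
    note sl = slice_Cons[of x p S] slice_Cons[of y q S] slice_Cons[of z e S]
    show ?thesis
    proof (cases "S ! x = S ! y \<and> S ! y = S ! z")
      case eq: True
      then show ?thesis
        using "1.IH"(1)[OF True eq] "1.prems" True sl lcs3_match[OF True eq] by simp
    next
      case False
      have "lcs3 S p q e x y z \<in> {lcs3 S p q e (Suc x) y z, lcs3 S p q e x (Suc y) z,
          lcs3 S p q e x y (Suc z)}"
        by (simp add: lcs3_mismatch[OF True False] Let_def)
      then show ?thesis
        using "1.IH"(2)[OF True False] "1.IH"(3)[OF True False refl]
          "1.IH"(4)[OF True False refl refl] "1.prems" True sl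
        by (auto intro: list_emb_Cons)
    qed
  qed (simp add: lcs3_outside)
qed

text \<open>On a mismatch the first letter of \<open>X\<close> differs from one of the three current
  letters, so that slice can lose its head and \<open>X\<close> still embeds. On a match
  \<open>tl X\<close> embeds in the three shortened slices, whether or not the first letter of
  \<open>X\<close> is the common one.\<close>

lemma length_le_lcs3:
  assumes "p \<le> length S" "q \<le> length S" "e \<le> length S"
    and "subseq X (slice S x p)" "subseq X (slice S y q)" "subseq X (slice S z e)"
  shows "length X \<le> length (lcs3 S p q e x y z)"
  using assms
proof (induction S p q e x y z arbitrary: X rule: lcs3.induct)
  case (1 S p q e x y z)
  show ?case
  proof (cases "x < p \<and> y < q \<and> z < e")
    case True
    have sl: "slice S x p = S ! x # slice S (Suc x) p" "slice S y q = S ! y # slice S (Suc y) q"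
      "slice S z e = S ! z # slice S (Suc z) e"
      using slice_Cons True "1.prems" by metis+
    show ?thesis
    proof (cases X)
      case (Cons v V)
      show ?thesis
      proof (cases "S ! x = S ! y \<and> S ! y = S ! z")
        case eq: True
        have "length (tl X) \<le> length (lcs3 S p q e (Suc x) (Suc y) (Suc z))"
          by (rule "1.IH"(1)[OF True eq])
            (use "1.prems" sl Cons eq in \<open>auto split: if_splits dest: subseq_Cons'\<close>)
        then show ?thesis
          using Cons lcs3_match[OF True eq] by simp
      next
        case False
        then have "length X \<le> length (lcs3 S p q e (Suc x) y z) \<or>
            length X \<le> length (lcs3 S p q e x (Suc y) z) \<or>
            length X \<le> length (lcs3 S p q e x y (Suc z))"
          using "1.IH"(2)[OF True False, of X] "1.IH"(3)[OF True False refl, of X]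
            "1.IH"(4)[OF True False refl refl, of X] "1.prems" sl
          by (simp add: Cons split: if_splits) 
        then show ?thesis
          by (auto simp: lcs3_mismatch[OF True False] Let_def)
      qed
    qed simp
  next
    case False
    then have "X = []"
      using "1.prems" by (auto simp: slice_empty not_less)
    then show ?thesis by simp
  qed
qed

lemma lcs3_nonempty: "lcs3 S p q e x y z \<noteq> [] \<Longrightarrow> x < p \<and> y < q \<and> z < e"
  using lcs3_outside by blast

definition cube :: "'a list \<Rightarrow> 'a list" where
  "cube X = X @ X @ X"

lemma length_cube [simp]: "length (cube X) = 3 * length X"
  by (simp add: cube_def)

text \<open>The cuts need not be ordered: the second part starts at \<open>p\<close> and the third
  at \<open>q\<close>, so a nonempty result forces \<open>i < p < q < e\<close>. The program can
  therefore run through all pairs of cuts without a test.\<close>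

lemma cubic_subseq_cube_lcs3:
  assumes "p \<le> length S" "q \<le> length S" "e \<le> length S"
  shows "cubic_subseq (slice S i e) (cube (lcs3 S p q e i p q))"
proof (cases "lcs3 S p q e i p q = []")
  case False
  then have "i < p" "p < q" "q < e"
    using lcs3_nonempty by blast+
  then have "slice S i e = slice S i p @ slice S p q @ slice S q e"
    by (simp add: slice_append)
  then show ?thesis
    using subseq_lcs3[OF assms, of i p q]
    by (auto simp: cubic_subseq_def cube_def intro!: list_emb_append_mono)
qed (simp add: cubic_subseq_def cube_def)

text \<open>The cuts are the places where an embedding of \<open>XXX\<close> passes from one copy to
  the next. They are strictly below \<open>e\<close> because the third copy is nonempty; this makes
  them digits in base \<open>n\<close> later.\<close>

lemma cubic_subseq_length_le:
  assumes "cubic_subseq (slice S i e) Y" "Y \<noteq> []" "e \<le> length S"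
  shows "\<exists>p q. p < e \<and> q < e \<and> length Y \<le> 3 * length (lcs3 S p q e i p q)"
proof -
  obtain X where Y: "Y = X @ X @ X" and sub: "subseq (X @ X @ X) (slice S i e)"
    using assms by (auto simp: cubic_subseq_def)
  obtain u v' where uv': "slice S i e = u @ v'" "subseq X u" "subseq (X @ X) v'"
    using list_emb_appendD[OF sub] by auto
  obtain v t where vt: "v' = v @ t" "subseq X v" "subseq X t"
    using list_emb_appendD[OF uv'(3)] by auto
  define p where "p = i + length u"
  define q where "q = p + length v"
  have "u \<noteq> []" "v \<noteq> []" "t \<noteq> []"
    using assms(2) Y uv'(2) vt by auto
  have len: "e - i = length u + length v + length t"
    using uv'(1) vt(1) length_slice[OF assms(3), of i] by (metis add.assoc length_append)
  moreover have "0 < length t" using \<open>t \<noteq> []\<close> by simp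
  ultimately have less: "p \<le> q" "q < e" "i \<le> p"
    unfolding p_def q_def by linarith+
  then have "slice S i p @ slice S p q @ slice S q e = u @ v @ t"
    using uv'(1) vt(1) by (simp add: slice_append)
  then have "u = slice S i p" "v = slice S p q" "t = slice S q e"
    using less assms(3) by (auto simp: append_eq_append_conv length_slice p_def q_def)
  then have "length X \<le> length (lcs3 S p q e i p q)"
    using length_le_lcs3[of p S q e X i p q] uv' vt less assms(3) by simp
  then show ?thesis
    using less Y by (intro exI[of _ p] exI[of _ q]) auto
qed

section \<open>Weakest preconditions with running time\<close>

text \<open>Stuck and diverging runs have no derivation in \<open>exec\<close>, so existence of one
  already includes termination, memory safety and absence of overflow. \<open>Q\<close> also
  receives the number of steps.\<close>

definition wp :: "nat \<Rightarrow> nat \<Rightarrow> com \<Rightarrow> (nat \<Rightarrow> state \<Rightarrow> bool) \<Rightarrow> state \<Rightarrow> bool" where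
  "wp N w c Q s \<longleftrightarrow> (\<exists>t s'. exec N w c s t s' \<and> Q t s')"

lemma wp_Skip [simp]: "wp N w Skip Q s \<longleftrightarrow> Q 1 s"
  unfolding wp_def One_nat_def by (metis One_nat_def exec.Skip exec_elims(1))

lemma wp_Const [simp]: "wp N w (Const x k) Q (r, m) \<longleftrightarrow> k < 2 ^ w \<and> Q 1 (r(x := k), m)"
  by (fastforce simp: wp_def intro: exec.intros elim: exec_elims)

lemma wp_Move [simp]: "wp N w (Move x y) Q (r, m) \<longleftrightarrow> Q 1 (r(x := r y), m)"
  by (fastforce simp: wp_def intro: exec.intros elim: exec_elims)

lemma wp_Op [simp]:
  "wp N w (Op f x y z) Q (r, m) \<longleftrightarrow>
    binop_val f (r y) (r z) < 2 ^ w \<and> Q 1 (r(x := binop_val f (r y) (r z)), m)"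
  by (fastforce simp: wp_def intro: exec.intros elim: exec_elims)

lemma wp_Load [simp]:
  "wp N w (Load x y) Q (r, m) \<longleftrightarrow> r y < N \<and> Q 1 (r(x := m (r y)), m)"
  by (fastforce simp: wp_def intro: exec.intros elim: exec_elims)

lemma wp_Store [simp]:
  "wp N w (Store x y) Q (r, m) \<longleftrightarrow> r x < N \<and> Q 1 (r, m(r x := r y))"
  by (fastforce simp: wp_def intro: exec.intros elim: exec_elims)

lemma wp_Seq [simp]:
  "wp N w (Seq c1 c2) Q s \<longleftrightarrow> wp N w c1 (\<lambda>t1. wp N w c2 (\<lambda>t2. Q (t1 + t2))) s"
  unfolding wp_def by (blast intro: exec.intros elim: exec_elims)

lemma wp_If [simp]:
  "wp N w (If b c1 c2) Q s \<longleftrightarrow>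
    (if guard_val b (fst s) then wp N w c1 (\<lambda>t. Q (1 + t)) s else wp N w c2 (\<lambda>t. Q (1 + t)) s)"
  unfolding wp_def plus_1_eq_Suc
  by (metis exec.IfTrue exec.IfFalse exec_elims(8) plus_1_eq_Suc)

lemma wp_mono: "wp N w c Q s \<Longrightarrow> (\<And>t s'. Q t s' \<Longrightarrow> Q' t s') \<Longrightarrow> wp N w c Q' s"
  unfolding wp_def by blast

text \<open>A round costs at most \<open>B + 1\<close> with its guard and lowers \<open>V\<close>,
  so there are at most \<open>K\<close> rounds; the failing test adds 1. The uniform bound
  \<open>B\<close> keeps step counts out of the invariant.\<close>

lemma wp_While:
  assumes "I s" "V s \<le> K"
    and step: "\<And>s. I s \<Longrightarrow> guard_val b (fst s) \<Longrightarrow>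
      wp N w c (\<lambda>t s'. t \<le> B \<and> I s' \<and> V s' < (V s :: nat)) s"
    and post: "\<And>t s. t \<le> 1 + K * (B + 1) \<Longrightarrow> I s \<Longrightarrow> \<not> guard_val b (fst s) \<Longrightarrow> Q t s"
  shows "wp N w (While b c) Q s"
proof -
  have "\<exists>t s'. exec N w (While b c) s t s' \<and> t \<le> 1 + V s * (B + 1) \<and> I s' \<and> \<not> guard_val b (fst s')"
    using \<open>I s\<close>
  proof (induction "V s" arbitrary: s rule: less_induct)
    case less
    show ?case
    proof (cases "guard_val b (fst s)")
      case True
      with step less.prems obtain t1 s1
        where s1: "exec N w c s t1 s1" "t1 \<le> B" "I s1" "V s1 < V s"
        unfolding wp_def by blast
      with less.hyps obtain t2 s2 where s2: "exec N w (While b c) s1 t2 s2"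
          "t2 \<le> 1 + V s1 * (B + 1)" "I s2" "\<not> guard_val b (fst s2)"
        by blast
      have "Suc (V s1) * (B + 1) \<le> V s * (B + 1)"
        using s1 by (intro mult_le_mono) auto
      then have "1 + t1 + t2 \<le> 1 + V s * (B + 1)"
        using s1 s2 by simp
      then show ?thesis
        using exec.WhileTrue[OF True s1(1) s2(1)] s2 by blast
    next
      case False
      then show ?thesis
        using exec.WhileFalse[OF False] less.prems by (intro exI[of _ 1] exI[of _ s]) simp
    qed
  qed
  moreover have "1 + V s * (B + 1) \<le> 1 + K * (B + 1)"
    using assms(2) by (intro add_left_mono mult_right_mono) simp_all
  ultimately show ?thesis
    using post unfolding wp_def by (meson le_trans)
qed

section \<open>The program\<close>

notation Seq (infixr ";;" 60)

abbreviation (input) "R_n \<equiv> 0 :: nat"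
abbreviation (input) "R_zero \<equiv> 2 :: nat"
abbreviation (input) "R_one \<equiv> 3 :: nat"

text \<open>The bound is copied, so \<open>y\<close> survives. The decrement precedes the body,
  which thus sees the values from the bound minus one down to 0.\<close>

definition count_down :: "reg \<Rightarrow> reg \<Rightarrow> com \<Rightarrow> com" where
  "count_down x y c = Move x y ;; While (Less R_zero x) (Op Sub x x R_one ;; c)"

text \<open>\<open>I (Suc k)\<close> speaks of the state before the decrement, whereas the body
  starts with \<open>x\<close> already at \<open>k\<close>. A round costs \<open>B + 2\<close>
  (guard, decrement, body); the other 2 steps are the copy and the last guard.
  \<open>K \<le> 2 ^ w\<close> suffices since only decremented values are checked for
  overflow.\<close>

lemma wp_count_down:
  assumes regs: "\<And>k r m. I k (r, m) \<Longrightarrow> r x = k \<and> r R_zero = 0 \<and> r R_one = 1"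
    and init: "I (r y) (r(x := r y), m)"
    and "r y \<le> K" "K \<le> 2 ^ w"
    and step: "\<And>k r m. k < K \<Longrightarrow> I (Suc k) (r, m) \<Longrightarrow>
      wp N w c (\<lambda>t s. t \<le> B \<and> I k s) (r(x := k), m)"
    and post: "\<And>t s. t \<le> 2 + K * (B + 2) \<Longrightarrow> I 0 s \<Longrightarrow> Q t s"
  shows "wp N w (count_down x y c) Q (r, m)"
  unfolding count_down_def wp_Seq wp_Move
proof (rule wp_While[where I = "\<lambda>s. fst s x \<le> K \<and> I (fst s x) s" and V = "\<lambda>s. fst s x"
      and K = K and B = "B + 1"])
  show "fst (r(x := r y), m) x \<le> K \<and> I (fst (r(x := r y), m) x) (r(x := r y), m)"
    "fst (r(x := r y), m) x \<le> K"
    using init \<open>r y \<le> K\<close> by simp_all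
next
  fix s assume *: "fst s x \<le> K \<and> I (fst s x) s" "guard_val (Less R_zero x) (fst s)"
  obtain r m where s: "s = (r, m)" by (cases s)
  with * regs have "0 < r x" and ones: "r R_one = 1" by fastforce+
  then obtain k where k: "r x = Suc k" by (cases "r x") auto
  have "k < K" "I (Suc k) (r, m)" using * s k by simp_all
  note step[OF this]
  then have "wp N w c (\<lambda>t s'. 1 + t \<le> B + 1 \<and> (fst s' x \<le> K \<and> I (fst s' x) s') \<and> fst s' x < fst s x)
      (r(x := k), m)"
    by (rule wp_mono) (use regs k s \<open>k < K\<close> in \<open>fastforce\<close>)
  then show "wp N w (Op Sub x x R_one ;; c)
      (\<lambda>t s'. t \<le> B + 1 \<and> (fst s' x \<le> K \<and> I (fst s' x) s') \<and> fst s' x < fst s x) s"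
    using \<open>k < K\<close> \<open>K \<le> 2 ^ w\<close> by (simp add: s k ones)
next
  fix t s
  assume "t \<le> 1 + K * (B + 1 + 1)" "fst s x \<le> K \<and> I (fst s x) s"
    "\<not> guard_val (Less R_zero x) (fst s)"
  moreover obtain r m where s: "s = (r, m)" by (cases s)
  ultimately have "t \<le> 1 + K * (B + 2)" "I (r x) (r, m)" "\<not> r R_zero < r x"
    by simp_all
  then have "I 0 s" using regs[of "r x" r m] s by simp
  then show "Q (1 + t) s"
    using post \<open>t \<le> 1 + K * (B + 2)\<close> by simp
qed

abbreviation (input) "R_M \<equiv> 4 :: nat"
abbreviation (input) "R_nn \<equiv> 5 :: nat"
abbreviation (input) "R_nnn \<equiv> 6 :: nat"
abbreviation (input) "R_MM \<equiv> 7 :: nat"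
abbreviation (input) "R_MMM \<equiv> 8 :: nat"
abbreviation (input) "R_D \<equiv> 9 :: nat"
abbreviation (input) "R_c \<equiv> 10 :: nat"
abbreviation (input) "R_p \<equiv> 11 :: nat"
abbreviation (input) "R_q \<equiv> 12 :: nat"
abbreviation (input) "R_e \<equiv> 13 :: nat"
abbreviation (input) "R_d \<equiv> 14 :: nat"
abbreviation (input) "R_x \<equiv> 15 :: nat"
abbreviation (input) "R_y \<equiv> 16 :: nat"
abbreviation (input) "R_z \<equiv> 17 :: nat"
abbreviation (input) "R_i \<equiv> 18 :: nat"
abbreviation (input) "R_L \<equiv> 19 :: nat"
abbreviation (input) "R_k \<equiv> 20 :: nat"
abbreviation (input) "R_a \<equiv> 21 :: nat"
abbreviation (input) "R_g \<equiv> 22 :: nat"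
abbreviation (input) "R_t \<equiv> 23 :: nat"
abbreviation (input) "R_u \<equiv> 24 :: nat"
abbreviation (input) "R_v \<equiv> 25 :: nat"
abbreviation (input) "R_s \<equiv> 26 :: nat"

text \<open>Positions serve directly as addresses, since the input starts at cell 0. In
  \<open>c1\<close> the common letter is available in \<open>R_t\<close>.\<close>

definition if_match :: "com \<Rightarrow> com \<Rightarrow> com" where
  "if_match c1 c2 =
    Load R_t R_x ;; Load R_u R_y ;; Load R_s R_z ;;
    If (Eq R_t R_u) (If (Eq R_u R_s) c1 c2) c2"

text \<open>The maximum of two entries is formed as \<open>a + (b - a)\<close> with truncated subtraction.\<close>

definition cell_cmd :: com where
  "cell_cmd =
    Op Div R_x R_d R_MM ;; Op Div R_y R_d R_M ;; Op Mod R_y R_y R_M ;; Op Mod R_z R_d R_M ;;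
    Op Add R_g R_D R_d ;; Const R_v 0 ;;
    If (Less R_x R_p) (If (Less R_y R_q) (If (Less R_z R_e)
      (if_match
        (Op Add R_t R_g R_MM ;; Op Add R_t R_t R_M ;; Op Add R_t R_t R_one ;;
         Load R_v R_t ;; Op Add R_v R_v R_one)
        (Op Add R_t R_g R_MM ;; Load R_v R_t ;;
         Op Add R_t R_g R_M ;; Load R_u R_t ;; Op Sub R_u R_u R_v ;; Op Add R_v R_v R_u ;;
         Op Add R_t R_g R_one ;; Load R_u R_t ;; Op Sub R_u R_u R_v ;; Op Add R_v R_v R_u))
      Skip) Skip) Skip ;;
    Store R_g R_v"

text \<open>A matched letter goes into all three copies at once, \<open>R_L\<close> cells apart.
  \<open>R_g\<close> follows the current table cell incrementally. On a mismatch, an entry equal to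
  the remaining length \<open>R_L - R_k\<close> marks a maximal neighbour; testing \<open>x\<close>,
  then \<open>y\<close>, with \<open>z\<close> as default is the tie-breaking of
  \<open>lcs3\<close>.\<close>

definition trace_cmd :: com where
  "trace_cmd =
    if_match
      (Op Add R_u R_a R_one ;; Op Add R_u R_u R_k ;; Store R_u R_t ;;
       Op Add R_u R_u R_L ;; Store R_u R_t ;; Op Add R_u R_u R_L ;; Store R_u R_t ;;
       Op Add R_x R_x R_one ;; Op Add R_y R_y R_one ;; Op Add R_z R_z R_one ;;
       Op Add R_k R_k R_one ;;
       Op Add R_g R_g R_MM ;; Op Add R_g R_g R_M ;; Op Add R_g R_g R_one)
      (Op Sub R_v R_L R_k ;;
       Op Add R_t R_g R_MM ;; Load R_u R_t ;;
       If (Eq R_u R_v) (Op Add R_x R_x R_one ;; Move R_g R_t)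
         (Op Add R_t R_g R_M ;; Load R_u R_t ;;
          If (Eq R_u R_v) (Op Add R_y R_y R_one ;; Move R_g R_t)
            (Op Add R_z R_z R_one ;; Op Add R_g R_g R_one)))"

definition update_cmd :: com where
  "update_cmd =
    Op Add R_a R_i R_one ;; Op Mul R_a R_a R_n ;; Op Add R_a R_a R_e ;; Op Sub R_a R_a R_one ;;
    Op Mul R_a R_a R_M ;;
    Op Mul R_g R_i R_M ;; Op Add R_g R_g R_p ;; Op Mul R_g R_g R_M ;; Op Add R_g R_g R_q ;;
    Op Add R_g R_g R_D ;;
    Load R_L R_g ;;
    Op Add R_u R_L R_L ;; Op Add R_u R_u R_L ;; Load R_v R_a ;;
    If (Less R_v R_u)
      (Store R_a R_u ;; Move R_x R_i ;; Move R_y R_p ;; Move R_z R_q ;; Const R_k 0 ;;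
       While (Less R_k R_L) trace_cmd)
      Skip"

definition split_cmd :: com where
  "split_cmd =
    Op Div R_p R_c R_nn ;; Op Div R_q R_c R_n ;; Op Mod R_q R_q R_n ;; Op Mod R_e R_c R_n ;;
    Op Add R_e R_e R_one ;;
    count_down R_d R_MMM cell_cmd ;;
    count_down R_i R_n update_cmd"

definition init_cmd :: com where
  "init_cmd = Op Add R_t R_c R_n ;; Op Mul R_u R_t R_M ;; Store R_t R_u"

text \<open>
  The loops over triples use one counter each, decoded by division: \<open>R_c < n\<^sup>3\<close> stands for the cut
  positions and the right end \<open>(p, q, e - 1)\<close>, and \<open>R_d < M\<^sup>3\<close> for the left ends \<open>(x, y, z)\<close>. Counting
  down visits the cells \<open>(x + 1, y, z)\<close>, \<open>(x, y + 1, z)\<close>, \<open>(x, y, z + 1)\<close> before \<open>(x, y, z)\<close>.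
\<close>

definition cubic_cmd :: com where
  "cubic_cmd =
    Const R_zero 0 ;; Const R_one 1 ;; Op Add R_M R_n R_one ;;
    Op Mul R_nn R_n R_n ;; Op Mul R_nnn R_nn R_n ;;
    Op Mul R_MM R_M R_M ;; Op Mul R_MMM R_MM R_M ;; Op Mul R_D R_n R_MM ;;
    count_down R_c R_nn init_cmd ;;
    count_down R_c R_nnn split_cmd"

lemma nat_mult_add_less: "a * B + b < A * B" if "a < A" "b < B" for a b A B :: nat
proof -
  have "Suc a * B \<le> A * B" using that by (intro mult_le_mono1) simp
  then show ?thesis using that by simp
qed

lemma add_diff_eq_max: "a + (b - a) = max a (b :: nat)"
  by simp

section \<open>Correctness\<close>

text \<open>
  Memory layout, with \<open>M = n + 1\<close>: the input fills \<open>[0, n)\<close>, the output table of addresses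
  \<open>[n, n * M)\<close>, the output strings \<open>[n * M, n * M\<^sup>2)\<close> and the table of the dynamic program
  \<open>[n * M\<^sup>2, n * M\<^sup>2 + M\<^sup>3)\<close>. The string belonging to the table entry at address \<open>a\<close> starts at \<open>a * M\<close>,
  which makes its \<open>M\<close> cells disjoint from those of the other strings.
\<close>

locale cubic_ram =
  fixes S :: "nat list" and n M N w :: nat
  assumes n_eq: "n = length S" and M_eq: "M = n + 1"
    and N_eq: "N = 2 * M * M * M" and N_le: "N \<le> 2 ^ w"
begin

text \<open>Base \<open>M\<close> instead of \<open>n\<close>, because \<open>n\<close> must be a
  digit too: the recurrence reads \<open>Suc z\<close>, which can equal \<open>n\<close>.\<close>

definition idx :: "nat \<Rightarrow> nat \<Rightarrow> nat \<Rightarrow> nat" where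
  "idx x y z = (x * M + y) * M + z"

definition D :: "nat \<Rightarrow> nat \<Rightarrow> nat \<Rightarrow> nat" where
  "D x y z = n * (M * M) + idx x y z"

definition len :: "nat \<Rightarrow> nat \<Rightarrow> nat \<Rightarrow> nat \<Rightarrow> nat \<Rightarrow> nat \<Rightarrow> nat" where
  "len p q e x y z = length (lcs3 S p q e x y z)"

definition base_regs :: "(nat \<Rightarrow> nat) \<Rightarrow> bool" where
  "base_regs r \<longleftrightarrow> r R_n = n \<and> r R_zero = 0 \<and> r R_one = 1 \<and> r R_M = M \<and>
    r R_nn = n * n \<and> r R_nnn = n * n * n \<and> r R_MM = M * M \<and> r R_MMM = M * M * M \<and>
    r R_D = n * (M * M)"

definition split_regs :: "nat \<Rightarrow> nat \<Rightarrow> nat \<Rightarrow> nat \<Rightarrow> (nat \<Rightarrow> nat) \<Rightarrow> bool" where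
  "split_regs c p q e r \<longleftrightarrow> base_regs r \<and> r R_c = c \<and> r R_p = p \<and> r R_q = q \<and> r R_e = e"

definition input :: "(nat \<Rightarrow> nat) \<Rightarrow> bool" where
  "input m \<longleftrightarrow> (\<forall>a<n. m a = S ! a)"

definition lcs_table :: "nat \<Rightarrow> nat \<Rightarrow> nat \<Rightarrow> nat \<Rightarrow> (nat \<Rightarrow> nat) \<Rightarrow> bool" where
  "lcs_table p q e k m \<longleftrightarrow>
    (\<forall>x\<le>n. \<forall>y\<le>n. \<forall>z\<le>n. k \<le> idx x y z \<longrightarrow> m (D x y z) = len p q e x y z)"

lemma idx_Suc:
  "idx (Suc x) y z = idx x y z + M * M" "idx x (Suc y) z = idx x y z + M" "idx x y (Suc z) = idx x y z + 1"
  by (simp_all add: idx_def algebra_simps)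

lemma D_shift:
  "D x y z + M * M = D (Suc x) y z" "D x y z + M = D x (Suc y) z" "Suc (D x y z) = D x y (Suc z)"
  by (simp_all add: D_def idx_Suc)

lemma M_pos [simp]: "0 < M"
  by (simp add: M_eq)

lemma less_M_iff: "x < M \<longleftrightarrow> x \<le> n"
  by (simp add: M_eq less_Suc_eq_le)

lemma idx_less: "x \<le> n \<Longrightarrow> y \<le> n \<Longrightarrow> z \<le> n \<Longrightarrow> idx x y z < M * M * M"
  unfolding idx_def less_M_iff[symmetric] by (intro nat_mult_add_less)

text \<open>The left side is the end of the memory layout; rounding \<open>n\<close> up to
  \<open>M\<close> gives the factor 2 in \<open>N\<close>.\<close>

lemma N_ge: "n * (M * M) + M * M * M \<le> N"
proof -
  have "n * (M * M) \<le> M * (M * M)"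
    by (intro mult_le_mono1) (simp add: M_eq)
  moreover have "N = M * (M * M) + M * (M * M)"
    by (simp add: N_eq mult.assoc)
  ultimately show ?thesis
    by (simp add: mult.assoc)
qed

lemma N_ge_2: "2 \<le> N"
  using M_pos unfolding N_eq by (metis mult.assoc mult_le_mono2 mult_pos_pos mult.right_neutral Suc_leI One_nat_def)

lemma M_le_N: "M \<le> N"
proof -
  have "M * 1 \<le> M * (M * M)"
    by (intro mult_le_mono2) (simp add: M_eq)
  then show ?thesis using N_ge unfolding mult.assoc mult_1_right by linarith
qed

lemma word_bounds: "n < N" "n < 2 ^ w" "0 < N" "(0::nat) < 2 ^ w" "Suc 0 < 2 ^ w" "M \<le> 2 ^ w"
  using N_ge_2 M_le_N N_le M_eq by auto

lemma D_less: "x \<le> n \<Longrightarrow> y \<le> n \<Longrightarrow> z \<le> n \<Longrightarrow> D x y z < N"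
proof -
  assume "x \<le> n" "y \<le> n" "z \<le> n"
  then show ?thesis
    using idx_less[of x y z] N_ge unfolding D_def by linarith
qed

lemma D_less_word: "x \<le> n \<Longrightarrow> y \<le> n \<Longrightarrow> z \<le> n \<Longrightarrow> D x y z < 2 ^ w"
  using D_less N_le less_le_trans by blast

lemma idx_decode:
  assumes "y \<le> n" "z \<le> n"
  shows "idx x y z div (M * M) = x" "idx x y z div M mod M = y" "idx x y z mod M = z"
  using assms by (simp_all add: idx_def div_mult2_eq less_M_iff)

lemma idx_encode: "idx (d div (M * M)) (d div M mod M) (d mod M) = d"
  by (simp add: idx_def div_mult2_eq)

lemma D_inject:
  assumes "x \<le> n" "y \<le> n" "z \<le> n" "x' \<le> n" "y' \<le> n" "z' \<le> n"
  shows "D x y z = D x' y' z' \<longleftrightarrow> x = x' \<and> y = y' \<and> z = z'"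
  using assms idx_decode by (metis D_def add_left_cancel)

lemma len_le:
  assumes "p \<le> n" "q \<le> n" "e \<le> n"
  shows "len p q e x y z \<le> n"
proof -
  have "subseq (lcs3 S p q e x y z) (slice S x p)"
    using subseq_lcs3 assms n_eq by blast
  then have "len p q e x y z \<le> p - x"
    using assms n_eq by (auto simp: len_def length_slice dest!: list_emb_length)
  then show ?thesis using assms by simp
qed

lemma len_outside: "\<not> (x < p \<and> y < q \<and> z < e) \<Longrightarrow> len p q e x y z = 0"
  by (simp add: len_def lcs3_outside)

lemma len_match:
  assumes "x < p" "y < q" "z < e" "S ! x = S ! y" "S ! y = S ! z"
  shows "len p q e x y z = Suc (len p q e (Suc x) (Suc y) (Suc z))"
  using lcs3_match[of x p y q z e S] assms by (simp add: len_def)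

lemma len_mismatch:
  assumes "x < p" "y < q" "z < e" "\<not> (S ! x = S ! y \<and> S ! y = S ! z)"
  shows "len p q e x y z =
    max (max (len p q e (Suc x) y z) (len p q e x (Suc y) z)) (len p q e x y (Suc z))"
  using lcs3_mismatch[of x p y q z e S] assms by (auto simp: len_def Let_def)

section \<open>Filling the table of the dynamic program\<close>

lemma lcs_table_step:
  assumes "lcs_table p q e (Suc k) m" "k = idx x y z" "x \<le> n" "y \<le> n" "z \<le> n"
  shows "lcs_table p q e k (m(D x y z := len p q e x y z))"
  unfolding lcs_table_def
proof (intro allI impI)
  fix x' y' z' assume *: "x' \<le> n" "y' \<le> n" "z' \<le> n" "k \<le> idx x' y' z'"
  show "(m(D x y z := len p q e x y z)) (D x' y' z') = len p q e x' y' z'"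
  proof (cases "idx x' y' z' = k")
    case True
    then show ?thesis using assms * D_inject[of x' y' z' x y z] by (simp add: D_def)
  next
    case False
    then have "D x' y' z' \<noteq> D x y z" using assms by (simp add: D_def)
    then show ?thesis using assms * False by (simp add: lcs_table_def)
  qed
qed

text \<open>\<open>m0\<close> is the memory at the start of the whole loop; the frame protects all
  that lies below the table. The bound 50 is generous, the longest path takes 25 steps.\<close>

lemma wp_cell_cmd:
  assumes "k < M * M * M" "split_regs c p q e r" "r R_d = Suc k" "input m" "lcs_table p q e (Suc k) m"
    and "p < n" "q < n" "e \<le> n"
    and frame: "\<forall>a. a < n * (M * M) \<longrightarrow> m a = m0 a"
  shows "wp N w cell_cmd (\<lambda>t (r', m'). t \<le> 50 \<and> r' R_d = k \<and> split_regs c p q e r' \<and>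
      lcs_table p q e k m' \<and> (\<forall>a. a < n * (M * M) \<longrightarrow> m' a = m0 a)) (r(R_d := k), m)"
proof -
  define x where "x = k div (M * M)"
  define y where "y = k div M mod M"
  define z where "z = k mod M"
  have k: "k = idx x y z"
    by (simp add: x_def y_def z_def idx_encode)
  have xyz: "x \<le> n" "y \<le> n" "z \<le> n"
    using assms(1) less_mult_imp_div_less[of k M "M * M"]
    by (simp_all add: x_def y_def z_def less_M_iff[symmetric] mult.assoc)
  have regs: "r R_n = n" "r R_zero = 0" "r R_one = 1" "r R_M = M"
    "r R_nn = n * n" "r R_nnn = n * n * n" "r R_MM = M * M" "r R_MMM = M * M * M"
    "r R_D = n * (M * M)" "r R_c = c" "r R_p = p" "r R_q = q" "r R_e = e"
    using assms(2) by (simp_all add: split_regs_def base_regs_def)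
  have S: "m a = S ! a" if "a < n" for a
    using assms that by (simp add: input_def)
  have MMM: "M * M * M \<le> N" "n * (M * M) \<le> N"
    using N_ge by linarith+
  have k_less: "k < 2 ^ w"
    using MMM assms(1) N_le by linarith
  have small: "x < 2 ^ w" "y < 2 ^ w" "z < 2 ^ w" "k div M < 2 ^ w"
    using k_less unfolding x_def y_def z_def
    by (auto intro: le_less_trans[OF div_le_dividend] le_less_trans[OF mod_less_eq_dividend]
      le_less_trans[OF order.trans[OF mod_less_eq_dividend div_le_dividend]])
  have D0: "n * (M * M) + k = D x y z"
    by (simp add: k D_def)
  have D_ge: "\<not> D x y z < n * (M * M)" by (simp add: D_def)
  have tab: "m (D x' y' z') = len p q e x' y' z'"
    if "x' \<le> n" "y' \<le> n" "z' \<le> n" "k < idx x' y' z'" for x' y' z'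
    using that assms(5) by (simp add: lcs_table_def)
  note step = lcs_table_step[OF assms(5) k xyz]
  note facts = cell_cmd_def if_match_def regs split_regs_def base_regs_def D0 small xyz step D_ge
    frame word_bounds
  consider (outside) "\<not> (x < p \<and> y < q \<and> z < e)"
    | (match) "x < p \<and> y < q \<and> z < e" "S ! x = S ! y \<and> S ! y = S ! z"
    | (mismatch) "x < p \<and> y < q \<and> z < e" "\<not> (S ! x = S ! y \<and> S ! y = S ! z)"
    by blast
  then show ?thesis
  proof cases
    case outside
    then have [simp]: "len p q e x y z = 0" by (rule len_outside)
    show ?thesis
      using outside step D_less[of x y z] D_less_word[of x y z]
      by (auto simp add: facts D_shift simp flip: x_def y_def z_def)
  next
    case match
    then have less: "x < n" "y < n" "z < n" using assms by auto
    note lessN = this[THEN less_trans[OF _ word_bounds(1)]]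
    have "k < idx (Suc x) (Suc y) (Suc z)" by (simp add: k idx_Suc)
    with less have m: "m (D (Suc x) (Suc y) (Suc z)) = len p q e (Suc x) (Suc y) (Suc z)"
      "Suc (len p q e (Suc x) (Suc y) (Suc z)) = len p q e x y z"
      using match by (simp_all add: tab len_match)
    show ?thesis
      using match step less D_less[of x y z] D_less_word[of x y z]
        len_le[of p q e x y z] word_bounds assms(6-8)
        D_less[of "Suc x" "Suc y" "Suc z"] D_less_word[of "Suc x" "Suc y" "Suc z"]
        D_less_word[of "Suc x" "Suc y" z] D_less_word[of "Suc x" y z]
        le_less_trans[OF len_le[of p q e x y z] word_bounds(2)]
      by (auto simp add: facts S m lessN D_shift simp flip: x_def y_def z_def)
  next
    case mismatch
    then have less: "x < n" "y < n" "z < n" using assms by auto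
    note lessN = this[THEN less_trans[OF _ word_bounds(1)]]
    have "k < idx (Suc x) y z" "k < idx x (Suc y) z" "k < idx x y (Suc z)"
      by (simp_all add: k idx_Suc)
    with less have m: "m (D (Suc x) y z) = len p q e (Suc x) y z"
      "m (D x (Suc y) z) = len p q e x (Suc y) z"
      "m (D x y (Suc z)) = len p q e x y (Suc z)"
      using mismatch by (simp_all add: tab)
    have l: "len p q e x y z =
      max (max (len p q e (Suc x) y z) (len p q e x (Suc y) z)) (len p q e x y (Suc z))"
      using mismatch by (intro len_mismatch) auto
    have le: "len p q e x' y' z' < 2 ^ w" for x' y' z'
      using assms(6-8) by (intro le_less_trans[OF len_le word_bounds(2)]) auto
    show ?thesis
      using mismatch step[unfolded l] less D_less[of x y z] D_less_word[of x y z]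
        word_bounds D_less[of "Suc x" y z] D_less_word[of "Suc x" y z]
        D_less[of x "Suc y" z] D_less_word[of x "Suc y" z]
        D_less[of x y "Suc z"] D_less_word[of x y "Suc z"]
      by (auto simp add: facts S m lessN add_diff_eq_max less_imp_diff_less[OF le] le
          D_shift simp flip: x_def y_def z_def)
  qed
qed

lemma n_le_D: "n \<le> n * (M * M)"
proof -
  have "n * 1 \<le> n * (M * M)"
    by (intro mult_le_mono2) (simp add: M_eq)
  then show ?thesis by simp
qed

lemma wp_cells:
  assumes "split_regs c p q e r" "input m" "p < n" "q < n" "e \<le> n"
    and post: "\<And>t r' m'. t \<le> 2 + M * M * M * 52 \<Longrightarrow> split_regs c p q e r' \<Longrightarrow>
      lcs_table p q e 0 m' \<Longrightarrow> \<forall>a < n * (M * M). m' a = m a \<Longrightarrow> Q t (r', m')"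
  shows "wp N w (count_down R_d R_MMM cell_cmd) Q (r, m)"
proof (rule wp_count_down[where K = "M * M * M" and B = 50 and
      I = "\<lambda>k (r', m'). r' R_d = k \<and> split_regs c p q e r' \<and> lcs_table p q e k m' \<and>
        (\<forall>a < n * (M * M). m' a = m a)"], goal_cases)
  case (1 k r m)
  then show ?case by (simp add: split_regs_def base_regs_def)
next
  case 2
  \<comment> \<open>The counter starts above every \<open>idx\<close>, so the claim about the table
    is vacuous. Hence entries left over from an earlier choice of cuts do no harm and nothing is
    cleared.\<close>
  have "r R_MMM = M * M * M"
    using assms(1) by (simp add: split_regs_def base_regs_def)
  then show ?case
    using assms(1) idx_less by (auto simp: split_regs_def base_regs_def lcs_table_def not_le[symmetric])
next
  case 3
  then show ?case using assms(1) by (simp add: split_regs_def base_regs_def)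
next
  case 4
  then show ?case using N_ge N_le by linarith
next
  case (5 k r' m')
  have "input m'"
    using assms(2) 5(2) less_le_trans[OF _ n_le_D] by (auto simp: input_def)
  then show ?case
    using wp_cell_cmd[OF 5(1), of c p q e r' m' m] 5(2) assms by (simp add: case_prod_unfold)
next
  case (6 t s)
  then show ?case using post by (cases s) auto
qed

section \<open>Traceback\<close>

definition trace_inv ::
  "nat \<Rightarrow> nat \<Rightarrow> nat \<Rightarrow> nat \<Rightarrow> nat \<Rightarrow> nat \<Rightarrow> nat list \<Rightarrow> (nat \<Rightarrow> nat) \<Rightarrow> state \<Rightarrow> bool" where
  "trace_inv c p q e i a X m0 = (\<lambda>(r, m). split_regs c p q e r \<and> r R_i = i \<and> r R_a = a \<and>
     r R_L = length X \<and> drop (r R_k) X = lcs3 S p q e (r R_x) (r R_y) (r R_z) \<and>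
     r R_k \<le> length X \<and> r R_g = D (r R_x) (r R_y) (r R_z) \<and> m a = 3 * length X \<and>
     (\<forall>l < r R_k. m (Suc (a + l)) = X ! l \<and> m (Suc (a + l + length X)) = X ! l \<and>
       m (Suc (a + l + length X + length X)) = X ! l) \<and>
     (\<forall>b. b < a \<or> a + n < b \<longrightarrow> m b = m0 b))"

text \<open>The suffix \<open>drop k X\<close> still to be written is \<open>lcs3\<close> at the
  current cell, so \<open>length X - k\<close> is the value of that cell. Writes stay within
  \<open>[a, a + n]\<close>, above the input and below the table, so both remain readable. A match
  lowers the variant by 3, a mismatch by 1.\<close>

lemma wp_trace_cmd:
  assumes inv: "trace_inv c p q e i a X m0 (r, m)" and "r R_k < length X"
    and "input m0" "lcs_table p q e 0 m0" "p < n" "q < n" "e \<le> n"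
    and X: "3 * length X \<le> n" and a: "n \<le> a" "a + n < n * (M * M)"
  shows "wp N w trace_cmd (\<lambda>t s. t \<le> 40 \<and> trace_inv c p q e i a X m0 s \<and>
    (p - fst s R_x) + (q - fst s R_y) + (e - fst s R_z) <
    (p - r R_x) + (q - r R_y) + (e - r R_z)) (r, m)"
proof -
  define x where "x = r R_x"
  define y where "y = r R_y"
  define z where "z = r R_z"
  define k where "k = r R_k"
  have drop: "drop k X = lcs3 S p q e x y z" and k: "k < length X" and
    mX: "m a = 3 * length X" "\<forall>l < k. m (Suc (a + l)) = X ! l \<and>
      m (Suc (a + l + length X)) = X ! l \<and> m (Suc (a + l + length X + length X)) = X ! l" and
    frame: "\<forall>b. b < a \<or> a + n < b \<longrightarrow> m b = m0 b"
    using assms by (simp_all add: trace_inv_def x_def y_def z_def k_def)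
  have regs: "r R_n = n" "r R_zero = 0" "r R_one = 1" "r R_M = M"
    "r R_nn = n * n" "r R_nnn = n * n * n" "r R_MM = M * M" "r R_MMM = M * M * M"
    "r R_D = n * (M * M)" "r R_c = c" "r R_p = p" "r R_q = q" "r R_e = e"
    "r R_x = x" "r R_y = y" "r R_z = z" "r R_k = k" "r R_L = length X" "r R_a = a" "r R_i = i"
    "r R_g = D x y z"
    using inv by (simp_all add: trace_inv_def split_regs_def base_regs_def x_def y_def z_def k_def)
  \<comment> \<open>As letters remain to be written, the cell lies inside the table region where all
    three parts are nonempty; this is why \<open>trace_cmd\<close> has no boundary test.\<close>
  have "lcs3 S p q e x y z \<noteq> []"
    using k drop by (metis drop_eq_Nil not_le)
  then have inside: "x < p" "y < q" "z < e"
    using lcs3_nonempty by blast+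
  then have less: "x < n" "y < n" "z < n" using assms by auto
  have m_S: "m x = S ! x" "m y = S ! y" "m z = S ! z"
    using less assms(3) a frame by (auto simp: input_def)
  have tab: "m (D x' y' z') = len p q e x' y' z'" if "x' \<le> n" "y' \<le> n" "z' \<le> n" for x' y' z'
    using that assms(4) a frame by (simp add: lcs_table_def D_def)
  have len: "len p q e x y z = length X - k"
    using arg_cong[OF drop, of length] by (simp add: len_def)
  note lessN = less[THEN less_trans[OF _ word_bounds(1)]]
  have lessw: "Suc x < 2 ^ w" "Suc y < 2 ^ w" "Suc z < 2 ^ w"
    using less word_bounds M_eq by auto
  have N: "a + n < N" "a + n < 2 ^ w"
    using N_ge N_le a by linarith+
  note facts = trace_cmd_def if_match_def regs m_S lessN lessw trace_inv_def split_regs_def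
    base_regs_def D_shift
  show ?thesis
  proof (cases "S ! x = S ! y \<and> S ! y = S ! z")
    case True
    note lcs = lcs3_match[of x p y q z e S]
    have "X ! k = S ! x" "drop (Suc k) X = lcs3 S p q e (Suc x) (Suc y) (Suc z)"
      using drop lcs inside True k by (metis Cons_nth_drop_Suc list.inject)+
    then show ?thesis
      using True less inside k N X mX frame
        D_less_word[of "Suc x" y z] D_less_word[of "Suc x" "Suc y" z]
        D_less_word[of "Suc x" "Suc y" "Suc z"]
      by (simp add: facts less_Suc_eq)
  next
    case False
    note lcs = lcs3_mismatch[of x p y q z e S] and max = len_mismatch[OF inside False]
    \<comment> \<open>By \<open>max\<close>, no neighbour exceeds \<open>length X - k\<close> and
      one attains it, so the equality tests select the branch taken by \<open>lcs3\<close>.\<close>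
    have step_x: "lcs3 S p q e x y z = lcs3 S p q e (Suc x) y z"
      if "len p q e (Suc x) y z = length X - k"
      using lcs inside False max len that by (auto simp: len_def Let_def)
    have step_y: "lcs3 S p q e x y z = lcs3 S p q e x (Suc y) z"
      if "len p q e (Suc x) y z \<noteq> length X - k" "len p q e x (Suc y) z = length X - k"
      using lcs inside False max len that by (auto simp: len_def Let_def)
    have step_z: "lcs3 S p q e x y z = lcs3 S p q e x y (Suc z)"
      if "len p q e (Suc x) y z \<noteq> length X - k" "len p q e x (Suc y) z \<noteq> length X - k"
      using lcs inside False max len that by (auto simp: len_def Let_def max_def split: if_splits)
    have decreasing: "p + q + e - Suc (x + y + z) < p + q + e - (x + y + z)"
      using inside by linarith
    have "length X - k < 2 ^ w"
      using X word_bounds(2) by linarith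
    then show ?thesis
      using False less inside k N X mX frame
        D_less_word[of "Suc x" y z] D_less_word[of x "Suc y" z] D_less_word[of x y "Suc z"]
        D_less[of "Suc x" y z] D_less[of x "Suc y" z] step_x step_y step_z decreasing
      by (simp add: facts tab drop)
  qed
qed

section \<open>Output slots and the strings kept in them\<close>

definition slot_index :: "nat \<Rightarrow> nat \<Rightarrow> nat" where
  "slot_index i e = Suc i * n + e"

definition slot :: "nat \<Rightarrow> nat \<Rightarrow> nat" where
  "slot i e = slot_index i e * M"

definition table :: "(nat \<Rightarrow> nat) \<Rightarrow> bool" where
  "table m \<longleftrightarrow> (\<forall>i<n. \<forall>e<n. m (slot_index i e) = slot i e)"

definition cube_at :: "nat \<Rightarrow> nat \<Rightarrow> nat list" where
  "cube_at c i = cube (lcs3 S (c div (n * n)) (c div n mod n) (Suc (c mod n)) i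
     (c div (n * n)) (c div n mod n))"

text \<open>\<open>Y\<close> has to dominate the candidates in \<open>A\<close> without being one of
  them, so empty strings suffice while \<open>A\<close> is empty. Maximality among all cubic
  subsequences is derived only once \<open>A\<close> is complete.\<close>

definition best :: "(nat \<times> nat) set \<Rightarrow> (nat \<Rightarrow> nat) \<Rightarrow> bool" where
  "best A m \<longleftrightarrow> (\<forall>i<n. \<forall>e<n. \<exists>Y. cubic_subseq (slice S i (Suc e)) Y \<and>
     stored_string N m (slot i e) Y \<and>
     (\<forall>c. (c, i) \<in> A \<longrightarrow> c mod n = e \<longrightarrow> length (cube_at c i) \<le> length Y))"

lemma slot_index_less: "i < n \<Longrightarrow> e < n \<Longrightarrow> slot_index i e < n * M"
  using nat_mult_add_less[of "Suc i" "Suc n" e n] by (simp add: slot_index_def M_eq)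

lemma slot_index_ge: "n \<le> slot_index i e"
  by (simp add: slot_index_def)

lemma slot_index_inject:
  assumes "e < n" "e' < n"
  shows "slot_index i e = slot_index i' e' \<longleftrightarrow> i = i' \<and> e = e'"
proof
  assume *: "slot_index i e = slot_index i' e'"
  have "slot_index j f div n = Suc j" "slot_index j f mod n = f" if "f < n" for j f
    using that unfolding slot_index_def by (simp_all del: mult_Suc)
  then show "i = i' \<and> e = e'" using * assms by (metis Suc_inject)
qed simp

lemma slot_ge: "n * M \<le> slot i e"
  by (simp add: slot_def slot_index_ge)

lemma slot_less: "i < n \<Longrightarrow> e < n \<Longrightarrow> slot i e + n < n * (M * M)"
  using nat_mult_add_less[of "slot_index i e" "n * M" n M] slot_index_less[of i e]
  by (simp add: slot_def less_M_iff mult.assoc)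

lemma slot_disjoint:
  assumes "e < n" "e' < n" "(i, e) \<noteq> (i', e')"
  shows "slot i e + n < slot i' e' \<or> slot i' e' + n < slot i e"
proof -
  have "slot_index i e < slot_index i' e' \<or> slot_index i' e' < slot_index i e"
    using slot_index_inject[OF assms(1,2), of i i'] assms(3) by auto
  moreover have "\<tau> * M + n < \<tau>' * M" if "\<tau> < \<tau>'" for \<tau> \<tau>'
  proof -
    have "Suc \<tau> * M \<le> \<tau>' * M" using that by (intro mult_le_mono1) simp
    then show ?thesis by (simp add: M_eq)
  qed
  ultimately show ?thesis by (auto simp: slot_def)
qed

lemma n_le_nM: "n \<le> n * M"
  by (simp add: M_eq)

lemma length_cubic_le: "cubic_subseq (slice S i (Suc e)) Y \<Longrightarrow> e < n \<Longrightarrow> length Y \<le> n"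
  using n_eq by (auto simp: cubic_subseq_def length_slice dest: list_emb_length)

lemma stored_string_cong:
  assumes "stored_string N m a Y" "length Y \<le> n" "\<forall>b. a \<le> b \<longrightarrow> b \<le> a + n \<longrightarrow> m' b = m b"
  shows "stored_string N m' a Y"
  using assms by (auto simp: stored_string_def)

lemma best_cong:
  assumes "best A m" "\<forall>a < n * (M * M). m' a = m a"
  shows "best A m'"
  unfolding best_def
proof (intro allI impI)
  fix i e assume ie: "i < n" "e < n"
  with assms(1) obtain Y where Y: "cubic_subseq (slice S i (Suc e)) Y" "stored_string N m (slot i e) Y"
    "\<forall>c. (c, i) \<in> A \<longrightarrow> c mod n = e \<longrightarrow> length (cube_at c i) \<le> length Y"
    unfolding best_def by blast
  have "stored_string N m' (slot i e) Y"
    using Y length_cubic_le[OF Y(1)] ie slot_less[OF ie] assms(2) by (intro stored_string_cong[OF Y(2)]) auto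
  then show "\<exists>Y. cubic_subseq (slice S i (Suc e)) Y \<and> stored_string N m' (slot i e) Y \<and>
     (\<forall>c. (c, i) \<in> A \<longrightarrow> c mod n = e \<longrightarrow> length (cube_at c i) \<le> length Y)"
    using Y by blast
qed

text \<open>Covers both outcomes of \<open>update_cmd\<close>: \<open>Y\<close> is the new cube, or
  the string already stored with \<open>m' = m\<close>. Since \<open>m (slot i e)\<close> is the old
  length, \<open>Y\<close> inherits domination over \<open>A\<close>.\<close>

lemma best_insert:
  assumes "best A m" "i < n" "e < n" "c mod n = e"
    and frame: "\<forall>b. b < slot i e \<or> slot i e + n < b \<longrightarrow> m' b = m b"
    and Y: "cubic_subseq (slice S i (Suc e)) Y" "stored_string N m' (slot i e) Y"
      "length (cube_at c i) \<le> length Y" "m (slot i e) \<le> length Y"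
  shows "best (insert (c, i) A) m'"
  unfolding best_def
proof (intro allI impI)
  fix i' e' assume ie: "i' < n" "e' < n"
  with assms(1) obtain Z where Z: "cubic_subseq (slice S i' (Suc e')) Z"
    "stored_string N m (slot i' e') Z"
    "\<forall>c. (c, i') \<in> A \<longrightarrow> c mod n = e' \<longrightarrow> length (cube_at c i') \<le> length Z"
    unfolding best_def by blast
  show "\<exists>Y. cubic_subseq (slice S i' (Suc e')) Y \<and> stored_string N m' (slot i' e') Y \<and>
     (\<forall>c'. (c', i') \<in> insert (c, i) A \<longrightarrow> c' mod n = e' \<longrightarrow> length (cube_at c' i') \<le> length Y)"
  proof (cases "(i', e') = (i, e)")
    case True
    then have "length Z \<le> length Y"
      using Z(2) Y(4) by (simp add: stored_string_def)
    then show ?thesis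
      using True Z(3) Y by (intro exI[of _ Y]) (auto intro: order.trans)
  next
    case False
    then have "stored_string N m' (slot i' e') Z"
      using frame slot_disjoint[of e' e i' i] ie assms(3) length_cubic_le[OF Z(1)]
      by (intro stored_string_cong[OF Z(2)]) auto
    then show ?thesis
      using False Z assms(4) by (intro exI[of _ Z]) auto
  qed
qed

lemma stored_cube:
  assumes "m a = 3 * length X" "a + 3 * length X < N"
    "\<forall>l < length X. m (Suc (a + l)) = X ! l \<and> m (Suc (a + l + length X)) = X ! l \<and>
      m (Suc (a + l + length X + length X)) = X ! l"
  shows "stored_string N m a (cube X)"
  unfolding stored_string_def
proof (intro conjI allI impI)
  fix l assume "l < length (cube X)"
  then consider "l < length X" | "length X \<le> l" "l - length X < length X" |
    "length X + length X \<le> l" "l - (length X + length X) < length X"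
    by fastforce
  then consider "l < length X" | j where "l = j + length X" "j < length X"
    | j where "l = j + length X + length X" "j < length X"
    by cases (metis le_add_diff_inverse2 add.assoc)+
  then show "m (a + 1 + l) = cube X ! l"
    using assms(3) by cases (simp_all add: cube_def nth_append add.assoc)
qed (use assms in simp_all)

lemma input_cong: "input m \<Longrightarrow> \<forall>b < n * M. m' b = m b \<Longrightarrow> input m'"
  using less_le_trans[OF _ n_le_nM] by (auto simp: input_def)

lemma table_cong: "table m \<Longrightarrow> \<forall>b < n * M. m' b = m b \<Longrightarrow> table m'"
  using slot_index_less by (simp add: table_def)

text \<open>Slots lie in \<open>[n * M, n * M^2)\<close>, between the address table and the table of
  the dynamic program.\<close>

lemma slot_frame:
  assumes "\<forall>b. b < slot i e \<or> slot i e + n < b \<longrightarrow> m' b = m b" "i < n" "e < n"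
  shows "input m \<Longrightarrow> input m'" "table m \<Longrightarrow> table m'"
    "lcs_table p q f k m \<Longrightarrow> lcs_table p q f k m'"
proof -
  have "\<forall>b < n * M. m' b = m b"
    using assms(1) slot_ge[of i e] by auto
  then show "input m \<Longrightarrow> input m'" "table m \<Longrightarrow> table m'"
    using input_cong table_cong by blast+
  have "m' (D x y z) = m (D x y z)" for x y z
    using slot_less[OF assms(2,3)] assms(1) by (simp add: D_def)
  then show "lcs_table p q f k m \<Longrightarrow> lcs_table p q f k m'"
    by (simp add: lcs_table_def)
qed

text \<open>In the time bound, \<open>3 * n\<close> bounds the traceback variant, as each part has
  at most \<open>n\<close> letters, and 41 is one traceback step with its guard.\<close>

lemma wp_update_cmd:
  assumes "k < n" "split_regs c p q (Suc e) r" "r R_i = Suc k" "input m" "table m" "best A m"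
    and "lcs_table p q (Suc e) 0 m" "p < n" "q < n" "e < n"
    and c: "p = c div (n * n)" "q = c div n mod n" "e = c mod n"
  shows "wp N w update_cmd (\<lambda>t (r', m'). t \<le> 60 + 3 * n * 41 \<and> split_regs c p q (Suc e) r' \<and>
    r' R_i = k \<and> input m' \<and> table m' \<and> best (insert (c, k) A) m' \<and> lcs_table p q (Suc e) 0 m')
    (r(R_i := k), m)"
proof -
  define X where "X = lcs3 S p q (Suc e) k p q"
  define a where "a = slot k e"
  have regs: "r R_n = n" "r R_zero = 0" "r R_one = 1" "r R_M = M"
    "r R_nn = n * n" "r R_nnn = n * n * n" "r R_MM = M * M" "r R_MMM = M * M * M"
    "r R_D = n * (M * M)" "r R_c = c" "r R_p = p" "r R_q = q" "r R_e = Suc e"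
    using assms(2) by (simp_all add: split_regs_def base_regs_def)
  have cube: "cube X = cube_at c k"
    by (simp add: X_def cube_at_def c)
  have cubic: "cubic_subseq (slice S k (Suc e)) (cube X)"
    unfolding X_def using assms n_eq by (intro cubic_subseq_cube_lcs3) simp_all
  have X3: "3 * length X \<le> n"
    using length_cubic_le[OF cubic \<open>e < n\<close>] by simp
  have a: "n \<le> a" "a + n < n * (M * M)"
    using order.trans[OF n_le_nM slot_ge] slot_less assms unfolding a_def by blast+
  then have aN: "a < N" "a < 2 ^ w"
    using N_ge N_le by linarith+
  have "Suc k * n + Suc e \<le> n * M"
    using slot_index_less[of k e] assms by (simp add: slot_index_def)
  \<comment> \<open>\<open>R_e\<close> holds \<open>Suc e\<close>, so before the subtraction
    \<open>R_a\<close> exceeds the slot index by one, and this value must fit into a word as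
    well.\<close>
  then have "Suc k * n + Suc e < 2 ^ w"
    using slot_ge[of k e] aN unfolding a_def by linarith
  then have aw: "n + k * n < 2 ^ w" "Suc (n + k * n + e) < 2 ^ w" "n + k * n + e < 2 ^ w" "Suc k < 2 ^ w"
    "(n + k * n + e) * M = a"
    using aN assms(1) word_bounds by (simp_all add: a_def slot_def slot_index_def)
  have g: "((k * M + p) * M + q) + n * (M * M) = D k p q"
    by (simp add: D_def idx_def)
  have Dkpq: "D k p q < N" "D k p q < 2 ^ w"
    using D_less[of k p q] D_less_word[of k p q] assms by simp_all
  have "k * M \<le> k * M + p" "k * M + p \<le> (k * M + p) * M" by (simp_all add: M_eq)
  then have gw: "k * M < 2 ^ w" "k * M + p < 2 ^ w" "(k * M + p) * M < 2 ^ w" "(k * M + p) * M + q < 2 ^ w"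
    using g Dkpq by linarith+
  have L: "m (D k p q) = length X"
    using assms by (simp add: lcs_table_def len_def X_def)
  have Lw: "length X + length X < 2 ^ w" "length X + length X + length X < 2 ^ w"
    using X3 word_bounds by linarith+
  note facts = regs aw gw g aN Dkpq L Lw split_regs_def base_regs_def
  show ?thesis
  proof (cases "m a < length X + length X + length X")
    case True
    let ?V = "\<lambda>s :: state. (p - fst s R_x) + (q - fst s R_y) + (Suc e - fst s R_z)"
    let ?s = "(r(R_i := k, R_a := a, R_g := D k p q, R_L := length X,
        R_u := length X + length X + length X, R_v := m a, R_x := k, R_y := p, R_z := q, R_k := 0),
        m(a := length X + length X + length X))"
    have "wp N w (While (Less R_k R_L) trace_cmd)
      (\<lambda>t (r', m'). t \<le> 1 + 3 * n * 41 \<and> split_regs c p q (Suc e) r' \<and> r' R_i = k \<and> input m' \<and>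
        table m' \<and> best (insert (c, k) A) m' \<and> lcs_table p q (Suc e) 0 m') ?s"
    proof (rule wp_While[where I = "trace_inv c p q (Suc e) k a X m" and V = ?V and K = "3 * n"
          and B = 40], goal_cases)
      case 1
      show ?case by (simp add: trace_inv_def facts flip: X_def)
    next
      case 2
      have "p \<le> n" "q \<le> n" "Suc e \<le> n" using assms(8-10) by simp_all
      then show ?case by simp
    next
      case (3 s)
      obtain r' m' where s: "s = (r', m')" by (cases s)
      then have "r' R_k < length X"
        using 3 by (simp add: trace_inv_def)
      then show ?case
        using wp_trace_cmd[of c p q "Suc e" k a X m r' m'] 3 s assms X3 a by simp
    next
      case (4 t s)
      obtain r' m' where s: "s = (r', m')" by (cases s)
      then have inv: "split_regs c p q (Suc e) r'" "r' R_i = k" "m' a = 3 * length X"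
        "\<forall>l < length X. m' (Suc (a + l)) = X ! l \<and> m' (Suc (a + l + length X)) = X ! l \<and>
          m' (Suc (a + l + length X + length X)) = X ! l"
        "\<forall>b. b < a \<or> a + n < b \<longrightarrow> m' b = m b"
        using 4 by (auto simp: trace_inv_def)
      have "stored_string N m' a (cube X)"
        using inv a N_ge X3 by (intro stored_cube) auto
      then have "best (insert (c, k) A) m'"
        using True inv(5) assms cubic by (intro best_insert[where Y = "cube X" and m = m and e = e])
          (simp_all add: a_def flip: cube)
      then show ?case
        using 4 inv slot_frame[OF inv(5)[unfolded a_def] \<open>k < n\<close> \<open>e < n\<close>] assms s by simp
    qed
    \<comment> \<open>20 of the 60 steps are spent before the loop, which leaves 40.\<close>
    then have "wp N w (While (Less R_k R_L) trace_cmd)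
      (\<lambda>t (r', m'). t \<le> 40 + 123 * n \<and> split_regs c p q (Suc e) r' \<and> r' R_i = k \<and> input m' \<and>
        table m' \<and> best (insert (c, k) A) m' \<and> lcs_table p q (Suc e) 0 m') ?s"
      by (rule wp_mono) auto
    then show ?thesis
      using True by (simp add: update_cmd_def facts)
  next
    case False
    have "best (insert (c, k) A) m"
    proof -
      obtain Y where "cubic_subseq (slice S k (Suc e)) Y" "stored_string N m a Y"
        using assms unfolding best_def a_def by blast
      then show ?thesis
        using False assms cube by (intro best_insert[of A m k e c m Y]) (auto simp: a_def stored_string_def simp flip: cube)
    qed
    then show ?thesis
      using False assms(1-10) by (simp add: update_cmd_def facts)
  qed
qed

text \<open>The pairs of a counter value and a left end treated when \<open>(k, j)\<close> has just been completed.\<close>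

definition handled :: "nat \<Rightarrow> nat \<Rightarrow> (nat \<times> nat) set" where
  "handled k j = {(c, i). c < n * n * n \<and> i < n \<and> (k < c \<or> k = c \<and> j \<le> i)}"

lemma handled_Suc: "k < n * n * n \<Longrightarrow> j < n \<Longrightarrow> handled k j = insert (k, j) (handled k (Suc j))"
  by (auto simp: handled_def)

text \<open>Lowering the outer counter adds nothing: no left end \<open>i < n\<close> satisfies
  \<open>n \<le> i\<close>.\<close>

lemma handled_next: "handled (Suc k) 0 = handled k n"
  by (auto simp: handled_def)

text \<open>The 9 consists of five decoding steps and 2 for each loop; 52 and 62 are the body bounds
  50 and 60 plus guard and decrement.\<close>

definition split_time :: nat where
  "split_time = 9 + M * M * M * 52 + n * (62 + 3 * n * 41)"

lemma wp_split_cmd: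
  assumes "k < n * n * n" "base_regs r" "r R_c = Suc k" "input m" "table m" "best (handled (Suc k) 0) m"
  shows "wp N w split_cmd (\<lambda>t (r', m'). t \<le> split_time \<and> base_regs r' \<and> r' R_c = k \<and>
    input m' \<and> table m' \<and> best (handled k 0) m') (r(R_c := k), m)"
proof -
  define p where "p = k div (n * n)"
  define q where "q = k div n mod n"
  define e where "e = k mod n"
  have "0 < n" using assms(1) by (cases n) auto
  then have pqe: "p < n" "q < n" "e < n"
    using assms(1) less_mult_imp_div_less[of k n "n * n"] by (simp_all add: p_def q_def e_def mult.assoc)
  have "n * n * n \<le> M * M * M"
    by (intro mult_le_mono) (simp_all add: M_eq)
  then have "k < 2 ^ w"
    using assms(1) N_ge N_le by linarith
  moreover have "k div n \<le> k" by simp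
  ultimately have kw: "k div n < 2 ^ w" "p < 2 ^ w" "q < 2 ^ w" "e < 2 ^ w" "Suc e < 2 ^ w"
    using pqe word_bounds by linarith+
  let ?Q = "\<lambda>t (r', m'). t \<le> split_time \<and> base_regs r' \<and> r' R_c = k \<and>
    input m' \<and> table m' \<and> best (handled k 0) m'"
  let ?r = "r(R_c := k, R_p := p, R_q := q, R_e := Suc e)"
  have regs: "r R_n = n" "r R_one = 1" "r R_nn = n * n"
    using assms(2) by (simp_all add: base_regs_def)
  have "wp N w (count_down R_d R_MMM cell_cmd)
    (\<lambda>t1. wp N w (count_down R_i R_n update_cmd) (\<lambda>t2. ?Q (Suc (Suc (Suc (Suc (Suc (t1 + t2)))))))) (?r, m)"
  proof (rule wp_cells[of k p q "Suc e"], goal_cases)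
    case 1
    show ?case using assms(2) by (simp add: split_regs_def base_regs_def)
  next
    case (6 t1 r1 m1)
    have "n * M \<le> n * (M * M)"
      by (simp add: M_eq)
    then have "\<forall>b < n * M. m1 b = m b"
      using 6(4) less_le_trans by blast
    then have "input m1" "table m1" "best (handled (Suc k) 0) m1"
      using assms input_cong table_cong best_cong 6(4) by blast+
    then show ?case
    proof (intro wp_count_down[where K = n and B = "60 + 3 * n * 41" and
        I = "\<lambda>j (r', m'). split_regs k p q (Suc e) r' \<and> r' R_i = j \<and> input m' \<and> table m' \<and>
          best (handled k j) m' \<and> lcs_table p q (Suc e) 0 m'"], goal_cases)
      case (1 j r m)
      then show ?case by (simp add: split_regs_def base_regs_def)
    next
      case 2
      then show ?case using 6 by (simp add: split_regs_def base_regs_def handled_next)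
    next
      case 3
      then show ?case using 6 by (simp add: split_regs_def base_regs_def)
    next
      case 4
      then show ?case using word_bounds by simp
    next
      case (5 j r' m')
      then show ?case
        using wp_update_cmd[OF 5(4), of k p q e r' m' "handled k (Suc j)"] pqe assms(1)
        by (simp add: handled_Suc p_def q_def e_def case_prod_unfold)
    next
      case (6 t s)
      then show ?case
        using \<open>t1 \<le> _\<close> by (cases s) (simp add: split_time_def split_regs_def algebra_simps)
    qed
  qed (use assms pqe in simp_all)
  then show ?thesis
    by (simp add: split_cmd_def regs kw flip: p_def q_def e_def)
qed

section \<open>Initial addresses, optimality at the end, and the whole program\<close>

lemma wp_init_cmd:
  assumes "k < n * n" "base_regs r" "r R_c = Suc k"
    and "\<forall>a. n + Suc k \<le> a \<longrightarrow> a < n * M \<longrightarrow> m a = a * M" "\<forall>a. a < n \<or> n * M \<le> a \<longrightarrow> m a = m0 a"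
  shows "wp N w init_cmd (\<lambda>t (r', m'). t \<le> 3 \<and> base_regs r' \<and> r' R_c = k \<and>
    (\<forall>a. n + k \<le> a \<longrightarrow> a < n * M \<longrightarrow> m' a = a * M) \<and> (\<forall>a. a < n \<or> n * M \<le> a \<longrightarrow> m' a = m0 a))
    (r(R_c := k), m)"
proof -
  have regs: "r R_n = n" "r R_M = M"
    using assms(2) by (simp_all add: base_regs_def)
  have "k + n < n * M" using assms(1) by (simp add: M_eq)
  then have "(k + n) * M < n * (M * M)" by simp
  moreover have "k + n \<le> (k + n) * M"
    by (simp add: M_eq)
  ultimately have "(k + n) * M < 2 ^ w" "k + n < 2 ^ w" "k + n < N"
    using N_ge N_le by linarith+
  then show ?thesis
    using assms(2,4,5) \<open>k + n < n * M\<close> by (auto simp add: init_cmd_def regs base_regs_def)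
qed

lemma base_regsD:
  "base_regs r \<Longrightarrow> r R_n = n \<and> r R_zero = 0 \<and> r R_one = 1 \<and> r R_nn = n * n \<and> r R_nnn = n * n * n"
  by (simp add: base_regs_def)

lemma base_regs_upd: "base_regs (r(R_c := k)) = base_regs r"
  by (simp add: base_regs_def)

text \<open>\<open>handled 0 0\<close> contains every counter value with every left end, hence also
  the cuts that \<open>cubic_subseq_length_le\<close> yields for an arbitrary competitor
  \<open>Z\<close>.\<close>

lemma longest_table:
  assumes "table m" "best (handled 0 0) m" "r R_n = n"
  shows "longest_cubic_table N S (r, m)"
proof -
  have *: "slot_index i e < N \<and> (\<exists>Y. longest_cubic_subseq (slice S i (Suc e)) Y \<and>
      stored_string N m (m (slot_index i e)) Y)" if ie: "i < n" "e < n" for i e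
  proof -
    obtain Y where Y: "cubic_subseq (slice S i (Suc e)) Y" "stored_string N m (slot i e) Y"
      "\<forall>c. (c, i) \<in> handled 0 0 \<longrightarrow> c mod n = e \<longrightarrow> length (cube_at c i) \<le> length Y"
      using assms(2) ie unfolding best_def by blast
    have "length Z \<le> length Y" if Z: "cubic_subseq (slice S i (Suc e)) Z" for Z
    proof (cases "Z = []")
      case False
      then obtain p q where pq: "p < Suc e" "q < Suc e"
        "length Z \<le> 3 * length (lcs3 S p q (Suc e) i p q)"
        using cubic_subseq_length_le[OF Z] ie n_eq by auto
      \<comment> \<open>The inverse of the decoding in \<open>cube_at\<close>: \<open>p\<close>,
        \<open>q\<close>, \<open>e\<close> are the base-\<open>n\<close> digits.\<close>
      define c where "c = (p * n + q) * n + e"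
      have "c mod n = e" "c div n = p * n + q"
        using ie by (simp_all add: c_def)
      have "c div (n * n) = p" "c div n mod n = q"
        using ie pq by (simp_all add: c_def div_mult2_eq)
      then have "length Z \<le> length (cube_at c i)"
        using pq \<open>c mod n = e\<close> by (simp add: cube_at_def)
      moreover have "c < n * n * n"
        unfolding c_def using ie pq by (intro nat_mult_add_less) simp_all
      then have "length (cube_at c i) \<le> length Y"
        using Y(3) \<open>c mod n = e\<close> ie unfolding handled_def by auto
      ultimately show ?thesis
        by linarith
    qed simp
    then have "longest_cubic_subseq (slice S i (Suc e)) Y"
      using Y(1) by (auto simp: longest_cubic_subseq_def is_arg_max_def not_less)
    moreover have "slot_index i e \<le> slot i e"
      unfolding slot_def by (simp add: M_eq)
    then have "slot_index i e < N"
      using slot_less[OF ie] N_ge by linarith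
    ultimately show ?thesis
      using assms(1) ie Y(2) by (auto simp: table_def)
  qed
  show ?thesis
    unfolding longest_cubic_table_def prod.case Let_def
  proof (intro allI impI)
    fix i j assume ij: "1 \<le> i \<and> i \<le> j \<and> j \<le> length S"
    then have "i - 1 < n" "j - 1 < n" "substring S i j = slice S (i - 1) (Suc (j - 1))"
      using n_eq by (auto simp: substring_eq_slice)
    \<comment> \<open>The address table was placed at address \<open>n\<close>, so register 0, still
      holding the input length, already is the required base address.\<close>
    moreover have "r 0 + (i - 1) * length S + (j - 1) = slot_index (i - 1) (j - 1)"
      by (simp add: slot_index_def assms(3) flip: n_eq)
    ultimately show "r 0 + (i - 1) * length S + (j - 1) < N \<and>
        (\<exists>Y. longest_cubic_subseq (substring S i j) Y \<and>
          stored_string N m (m (r 0 + (i - 1) * length S + (j - 1))) Y)"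
      using * by (simp only:)
  qed
qed

text \<open>The 12 is eight setup steps plus 2 for each loop; 5 is \<open>init_cmd\<close> with
  guard and decrement.\<close>

lemma wp_cubic_cmd:
  "wp N w cubic_cmd (\<lambda>t s. t \<le> 12 + n * n * 5 + n * n * n * (split_time + 2) \<and>
    longest_cubic_table N S s) (init_state S)"
proof -
  define r0 :: "nat \<Rightarrow> nat" where "r0 = (\<lambda>_. 0)(R_n := n)"
  define m0 :: "nat \<Rightarrow> nat" where "m0 = (\<lambda>a. if a < n then S ! a else 0)"
  define r where "r = r0(R_zero := 0, R_one := 1, R_M := M, R_nn := n * n, R_nnn := n * n * n,
    R_MM := M * M, R_MMM := M * M * M, R_D := n * (M * M))"
  have init: "init_state S = (r0, m0)"
    by (simp add: init_state_def r0_def m0_def n_eq)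
  have r: "base_regs r"
    by (simp add: r_def r0_def base_regs_def)
  have M: "n \<le> M" "M \<le> M * M" "M * M \<le> M * M * M"
    by (simp_all add: M_eq)
  have "n * n * n \<le> M * M * M" "n * n \<le> n * (M * M)"
    using M(1,2) by (intro mult_le_mono mult_le_mono2; linarith)+
  moreover note M
  moreover have "0 < M * M * M" "N = M * M * M + M * M * M"
    by (simp_all add: N_eq M_eq algebra_simps)
  ultimately have bounds: "n * n * n < 2 ^ w" "n * n < 2 ^ w" "M * M < 2 ^ w" "M * M * M < 2 ^ w"
    "n * (M * M) < 2 ^ w" "M < 2 ^ w"
    using N_le N_ge by linarith+
  let ?Q = "\<lambda>t s. t \<le> 12 + n * n * 5 + n * n * n * (split_time + 2) \<and> longest_cubic_table N S s"
  have loops: "wp N w (count_down R_c R_nn init_cmd)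
    (\<lambda>t1. wp N w (count_down R_c R_nnn split_cmd) (\<lambda>t2. ?Q (Suc (Suc (Suc (Suc (Suc (Suc (Suc (Suc (t1 + t2))))))))))) (r, m0)"
  proof (rule wp_count_down[where K = "n * n" and B = 3 and
        I = "\<lambda>k (r', m'). base_regs r' \<and> r' R_c = k \<and>
          (\<forall>a. n + k \<le> a \<longrightarrow> a < n * M \<longrightarrow> m' a = a * M) \<and>
          (\<forall>a. a < n \<or> n * M \<le> a \<longrightarrow> m' a = m0 a)"], goal_cases)
    case (1 k r m)
    then show ?case using base_regsD by simp
  next
    case 2
    have "n * M = n + n * n" by (simp add: M_eq)
    then show ?case using r base_regsD[OF r] by (simp add: base_regs_upd)
  next
    case 3
    then show ?case using r base_regsD by simp
  next
    case 4
    then show ?case using bounds by simp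
  next
    case (5 k r' m')
    then show ?case using wp_init_cmd[of k r' m' m0] by (auto simp: case_prod_unfold)
  next
    case (6 t1 s)
    obtain r1 m1 where s: "s = (r1, m1)" by (cases s)
    have m1: "\<forall>a. n \<le> a \<longrightarrow> a < n * M \<longrightarrow> m1 a = a * M" "\<forall>a. a < n \<or> n * M \<le> a \<longrightarrow> m1 a = m0 a"
      "base_regs r1"
      using 6(2) s by auto
    have "input m1"
      using m1 by (simp add: input_def m0_def)
    moreover have "table m1"
      using m1 slot_index_less slot_index_ge by (simp add: table_def slot_def)
    moreover have "best (handled (n * n * n) 0) m1"
      unfolding best_def
    proof (intro allI impI)
      fix i e assume ie: "i < n" "e < n"
      then have "n \<le> slot i e" "slot i e < N"
        using order.trans[OF n_le_nM slot_ge] slot_less[OF ie] N_ge by (blast, linarith)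
      \<comment> \<open>Memory beyond the input is initially 0, and a length cell 0 already
        represents the empty string, so slots need no initialisation.\<close>
      then have "stored_string N m1 (slot i e) []"
        using m1 slot_ge by (simp add: stored_string_def m0_def)
      then show "\<exists>Y. cubic_subseq (slice S i (Suc e)) Y \<and> stored_string N m1 (slot i e) Y \<and>
          (\<forall>c. (c, i) \<in> handled (n * n * n) 0 \<longrightarrow> c mod n = e \<longrightarrow> length (cube_at c i) \<le> length Y)"
        by (intro exI[of _ "[]"]) (auto simp: handled_def cubic_subseq_def)
    qed
    ultimately show ?case
      unfolding s
    proof (intro wp_count_down[where K = "n * n * n" and B = split_time and
          I = "\<lambda>k (r', m'). base_regs r' \<and> r' R_c = k \<and> input m' \<and> table m' \<and> best (handled k 0) m'"],
          goal_cases)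
      case (1 k r m)
      then show ?case using base_regsD by simp
    next
      case 2
      then show ?case using m1 base_regsD[OF m1(3)] by (simp add: base_regs_upd)
    next
      case 3
      then show ?case using base_regsD[OF m1(3)] by simp
    next
      case 4
      then show ?case using bounds by simp
    next
      case (5 k r' m')
      then show ?case using wp_split_cmd[of k r' m'] by (auto simp: case_prod_unfold)
    next
      case (6 t s)
      then show ?case
        using \<open>t1 \<le> _\<close> longest_table base_regsD by (cases s) auto
    qed
  qed
  have Suc_n: "Suc n = M"
    by (simp add: M_eq)
  from loops show ?thesis
    unfolding init
    by (simp add: cubic_cmd_def r_def r0_def bounds word_bounds Suc_n)
qed

end

section \<open>Resource bounds\<close>

definition time_bound :: "nat \<Rightarrow> nat" where
  "time_bound n = 12 + n * n * 5 +
    n * n * n * (11 + (n + 1) * (n + 1) * (n + 1) * 52 + n * (62 + 3 * n * 41))"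

definition space_bound :: "nat \<Rightarrow> nat" where
  "space_bound n = 2 * (n + 1) * (n + 1) * (n + 1)"

text \<open>The factor 3 and the summand 1 match the shape \<open>2 * (m + 1)^3\<close> of
  \<open>space_bound\<close>. It is applied to \<open>n + \<sigma>\<close>, so that words hold both
  addresses and letters.\<close>

definition word_length :: "nat \<Rightarrow> nat" where
  "word_length m = 1 + 3 * nat \<lceil>log 2 (real (m + 1))\<rceil>"

lemma le_two_power_log: "m + 1 \<le> 2 ^ nat \<lceil>log 2 (real (m + 1))\<rceil>"
proof -
  have "real (m + 1) = 2 powr log 2 (real (m + 1))"
    by simp
  also have "\<dots> \<le> 2 powr real (nat \<lceil>log 2 (real (m + 1))\<rceil>)"
    by (intro powr_mono real_nat_ceiling_ge) simp
  also have "\<dots> = real (2 ^ nat \<lceil>log 2 (real (m + 1))\<rceil>)"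
    by (simp only: powr_realpow of_nat_power of_nat_numeral zero_less_numeral)
  finally show ?thesis
    by (simp only: of_nat_le_iff)
qed

lemma space_bound_le: "space_bound m \<le> 2 ^ word_length m"
proof -
  let ?b = "2 ^ nat \<lceil>log 2 (real (m + 1))\<rceil> :: nat"
  have "2 * (m + 1) * (m + 1) * (m + 1) \<le> 2 * ?b * ?b * ?b"
    using le_two_power_log[of m] by (intro mult_le_mono) simp_all
  also have "\<dots> = 2 ^ word_length m"
    by (simp add: word_length_def power_add power_mult power3_eq_cube mult.commute[of 3])
  finally show ?thesis
    by (simp add: space_bound_def)
qed

lemma word_length_bigo: "(\<lambda>n. real (word_length n)) \<in> O(\<lambda>n. ln (real n))"
proof -
  \<comment> \<open>Removing the ceiling costs at most 1, taken three times, on top of the summand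
    1.\<close>
  have "(\<lambda>n. real (word_length n)) \<in> O(\<lambda>n. 4 + 3 * log 2 (real n + 1))"
  proof (intro bigoI[of _ 1] always_eventually allI)
    fix n
    have nonneg: "0 \<le> log 2 (real n + 1)" by simp
    have "real (nat \<lceil>log 2 (real n + 1)\<rceil>) \<le> log 2 (real n + 1) + 1"
      using nonneg by linarith
    moreover have "real (word_length n) = 1 + 3 * real (nat \<lceil>log 2 (real n + 1)\<rceil>)"
      by (simp only: word_length_def of_nat_add of_nat_mult of_nat_1 of_nat_numeral)
    ultimately show "norm (real (word_length n)) \<le> 1 * norm (4 + 3 * log 2 (real n + 1))"
      using nonneg by (simp only: real_norm_def mult_1)
  qed
  also have "(\<lambda>n::nat. 4 + 3 * log 2 (real n + 1)) \<in> O(\<lambda>n. ln (real n))"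
    unfolding log_def by real_asymp
  finally show ?thesis .
qed

lemma time_bound_bigo: "(\<lambda>n. real (time_bound n)) \<in> O(\<lambda>n. real n ^ 6)"
  unfolding time_bound_def of_nat_add of_nat_mult of_nat_numeral of_nat_1 by real_asymp

lemma space_bound_bigo: "(\<lambda>n. real (space_bound n)) \<in> O(\<lambda>n. real n ^ 3)"
  unfolding space_bound_def of_nat_add of_nat_mult of_nat_numeral of_nat_1 by real_asymp

theorem theorem1:
  "\<exists>(P :: com) (T :: nat \<Rightarrow> nat) (N :: nat \<Rightarrow> nat) (w :: nat \<Rightarrow> nat).
     (\<lambda>n. real (T n)) \<in> O(\<lambda>n. real n ^ 6) \<and>
     (\<lambda>n. real (N n)) \<in> O(\<lambda>n. real n ^ 3) \<and>
     (\<lambda>n. real (w n)) \<in> O(\<lambda>n. ln (real n)) \<and>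
     (\<forall>(\<sigma> :: nat) (S :: nat list) (n :: nat).
        set S \<subseteq> {..<\<sigma>} \<and> length S = n \<longrightarrow>
          input_fits (N n) (w (n + \<sigma>)) S \<and>
          (\<exists>t s. exec (N n) (w (n + \<sigma>)) P (init_state S) t s \<and>
                 t \<le> T n \<and> longest_cubic_table (N n) S s))"
proof (rule exI[of _ cubic_cmd], rule exI[of _ time_bound], rule exI[of _ space_bound],
    rule exI[of _ word_length], intro conjI time_bound_bigo space_bound_bigo word_length_bigo allI impI)
  fix \<sigma> :: nat and S :: "nat list" and n :: nat
  assume S: "set S \<subseteq> {..<\<sigma>} \<and> length S = n"
  let ?w = "word_length (n + \<sigma>)"
  have le: "n + \<sigma> + 1 \<le> 2 ^ ?w"
  proof -
    have "n + \<sigma> + 1 \<le> space_bound (n + \<sigma>)"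
      by (simp add: space_bound_def)
    then show ?thesis using space_bound_le[of "n + \<sigma>"] by linarith
  qed
  have "a < 2 ^ ?w" if "a \<in> set S" for a
  proof -
    have "a < \<sigma>" using that S by auto
    then show ?thesis using le by linarith
  qed
  moreover have "n < 2 ^ ?w" using le by linarith
  moreover have "n \<le> space_bound n" by (simp add: space_bound_def)
  ultimately show "input_fits (space_bound n) ?w S"
    using S by (simp add: input_fits_def)
  have "space_bound n \<le> space_bound (n + \<sigma>)"
    unfolding space_bound_def by (intro mult_le_mono) simp_all
  then have "space_bound n \<le> 2 ^ ?w"
    using space_bound_le order.trans by blast
  then have "cubic_ram S n (n + 1) (space_bound n) ?w"
    using S by (simp add: cubic_ram_def space_bound_def)
  then interpret cubic_ram S n "n + 1" "space_bound n" ?w .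
  have "split_time + 2 = 11 + (n + 1) * (n + 1) * (n + 1) * 52 + n * (62 + 3 * n * 41)"
    unfolding split_time_def by linarith
  then have "12 + n * n * 5 + n * n * n * (split_time + 2) = time_bound n"
    unfolding time_bound_def by (simp only:)
  then show "\<exists>t s. exec (space_bound n) ?w cubic_cmd (init_state S) t s \<and> t \<le> time_bound n \<and>
      longest_cubic_table (space_bound n) S s"
    using wp_cubic_cmd unfolding wp_def by auto
qed

end
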